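(* Let $k$ be an integer with $4\le k\le 6$ and let $M$ be a finite matroid. If $M$ has a circuit-cocircuit intersection of size $k$, then $M$ has a circuit-cocircuit intersection of size $k-2$.
   Context: All matroids are finite. A cocircuit of a matroid $M$ is a circuit of the dual matroid $M^{\ast}$. A subset $X$ of the ground set $E(M)$ is called a circuit-cocircuit intersection of $M$ if $X=C\cap D$ for some circuit $C$ of $M$ and some cocircuit $D$ of $M$. *)

theory Defs
  imports Main
begin

locale matroid =
  fixes E :: "'a set" and indep :: "'a set \<Rightarrow> bool"
  assumes finite_ground: "finite E"
    and indep_subset_ground: "indep X \<Longrightarrow> X \<subseteq> E"
    and indep_empty: "indep {}"
    and indep_subset: "indep X \<Longrightarrow> Y \<subseteq> X \<Longrightarrow> indep Y"
    and indep_augment: "indep X \<Longrightarrow> indep Y \<Longrightarrow> card X < card Y \<Longrightarrow>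
      \<exists>y\<in>Y - X. indep (insert y X)"

definition basis :: "'a set \<Rightarrow> ('a set \<Rightarrow> bool) \<Rightarrow> 'a set \<Rightarrow> bool" where
  "basis E indep B \<longleftrightarrow> B \<subseteq> E \<and> indep B \<and> (\<forall>X\<subseteq>E. indep X \<longrightarrow> B \<subseteq> X \<longrightarrow> X = B)"

definition circuit :: "'a set \<Rightarrow> ('a set \<Rightarrow> bool) \<Rightarrow> 'a set \<Rightarrow> bool" where
  "circuit E indep C \<longleftrightarrow> C \<subseteq> E \<and> \<not> indep C \<and> (\<forall>X. X \<subset> C \<longrightarrow> indep X)"

text \<open>The bases of the dual matroid are the complements of the bases, so its independent sets
  are the subsets of such complements.\<close>

definition dual_indep :: "'a set \<Rightarrow> ('a set \<Rightarrow> bool) \<Rightarrow> 'a set \<Rightarrow> bool" where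
  "dual_indep E indep X \<longleftrightarrow> (\<exists>B. basis E indep B \<and> X \<subseteq> E - B)"

definition cocircuit :: "'a set \<Rightarrow> ('a set \<Rightarrow> bool) \<Rightarrow> 'a set \<Rightarrow> bool" where
  "cocircuit E indep D \<longleftrightarrow> circuit E (dual_indep E indep) D"

definition circuit_cocircuit_intersection ::
    "'a set \<Rightarrow> ('a set \<Rightarrow> bool) \<Rightarrow> 'a set \<Rightarrow> bool" where
  "circuit_cocircuit_intersection E indep X \<longleftrightarrow>
    (\<exists>C D. circuit E indep C \<and> cocircuit E indep D \<and> X = C \<inter> D)"

context matroid
begin

lemma finite_indep: "indep X \<Longrightarrow> finite X"
  using finite_ground indep_subset_ground finite_subset by blast

lemma extend_from:
  assumes "indep X" "indep Y" "card X \<le> card Y"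
  shows "\<exists>Z. indep Z \<and> X \<subseteq> Z \<and> Z \<subseteq> X \<union> Y \<and> card Z = card Y"
  using assms
proof (induction "card Y - card X" arbitrary: X)
  case 0
  then show ?case by (intro exI[of _ X]) auto
next
  case (Suc n)
  then have "card X < card Y" by linarith
  then obtain y where y: "y \<in> Y - X" "indep (insert y X)"
    using indep_augment Suc.prems by blast
  have c: "card (insert y X) = Suc (card X)"
    using y finite_indep Suc.prems by simp
  have "n = card Y - card (insert y X)" "card (insert y X) \<le> card Y"
    using c Suc.hyps(2) by linarith+
  from Suc.hyps(1)[OF this(1) y(2) Suc.prems(2) this(2)]
  obtain Z where "indep Z" "insert y X \<subseteq> Z" "Z \<subseteq> insert y X \<union> Y" "card Z = card Y"
    by blast
  with y show ?case by blast
qed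

lemma basis_card_ge:
  assumes "basis E indep B" "indep X"
  shows "card X \<le> card B"
proof (rule ccontr)
  assume "\<not> card X \<le> card B"
  then obtain y where "y \<in> X - B" "indep (insert y B)"
    using indep_augment[of B X] assms unfolding basis_def by auto
  then show False
    using assms(1) indep_subset_ground unfolding basis_def by blast
qed

lemma basis_iff_card:
  assumes "basis E indep B" "indep X"
  shows "basis E indep X \<longleftrightarrow> card X = card B"
proof
  assume "basis E indep X"
  then show "card X = card B"
    using basis_card_ge[OF assms] basis_card_ge[of X B] assms(1) by (simp add: basis_def)
next
  assume "card X = card B"
  then have "X = Y" if "indep Y" "X \<subseteq> Y" for Y
    using card_seteq[OF finite_indep[OF that(1)] that(2)] basis_card_ge[OF assms(1) that(1)] by simp
  then show "basis E indep X"
    unfolding basis_def using assms(2) indep_subset_ground by blast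
qed

lemma basis_exists: "\<exists>B. basis E indep B"
proof -
  have "finite {X. indep X}"
    using finite_ground indep_subset_ground by (auto intro: finite_subset[of _ "Pow E"])
  then obtain B where "indep B" "\<And>X. indep X \<Longrightarrow> B \<subseteq> X \<Longrightarrow> X = B"
    using finite_has_maximal[of "{X. indep X}"] indep_empty by blast
  then show ?thesis
    unfolding basis_def using indep_subset_ground by blast
qed

theorem dual_matroid: "matroid E (dual_indep E indep)"
proof
  show "finite E" by (rule finite_ground)
  show "X \<subseteq> E" if "dual_indep E indep X" for X
    using that unfolding dual_indep_def by blast
  show "dual_indep E indep {}"
    using basis_exists unfolding dual_indep_def by blast
  show "dual_indep E indep Y" if "dual_indep E indep X" "Y \<subseteq> X" for X Y
    using that unfolding dual_indep_def by blast
next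
  fix X Y
  assume "dual_indep E indep X" "dual_indep E indep Y" and less: "card X < card Y"
  then obtain A B where A: "basis E indep A" "X \<subseteq> E - A" and B: "basis E indep B" "Y \<subseteq> E - B"
    unfolding dual_indep_def by blast
  have fin: "finite X" "finite Y" "finite B"
    using A B finite_ground by (auto simp: basis_def intro: finite_subset[of _ E])
  have iA: "indep A" and iB: "indep B" using A B unfolding basis_def by auto
  have AB: "card A = card B" using basis_iff_card[OF A(1) iB] B(1) by simp
  have iBX: "indep (B - X)" using iB indep_subset by blast
  have "card (B - X) \<le> card A"
    using basis_card_ge[OF A(1) iBX] .
  then obtain Z where Z: "indep Z" "B - X \<subseteq> Z" "Z \<subseteq> (B - X) \<union> A" "card Z = card A"
    using extend_from[OF iBX iA] by blast
  have bZ: "basis E indep Z" using basis_iff_card[OF A(1) Z(1)] Z(4) by blast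
  have "\<not> Y - X \<subseteq> Z"
  proof
    assume "Y - X \<subseteq> Z"
    then have "card ((B - X) \<union> (Y - X)) \<le> card Z"
      using Z finite_indep by (intro card_mono) auto
    moreover have "card ((B - X) \<union> (Y - X)) = card (B - X) + card (Y - X)"
      using fin B(2) by (intro card_Un_disjoint) auto
    moreover have "card B = card (B - X) + card (B \<inter> X)"
      using fin card_Int_Diff[of B X] by simp
    moreover have "card (B \<inter> X) \<le> card (X - Y)"
      using B(2) fin by (intro card_mono) auto
    moreover have "card (X - Y) < card (Y - X)"
      using less fin by (simp add: card_less_sym_Diff)
    ultimately show False using Z(4) AB by linarith
  qed
  then obtain y where y: "y \<in> Y - X" "y \<notin> Z" by blast
  have "insert y X \<subseteq> E - Z" using y A(2) B(2) Z(3) by blast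
  then show "\<exists>y\<in>Y - X. dual_indep E indep (insert y X)"
    using y bZ unfolding dual_indep_def by blast
qed

lemma basis_dual_iff: "basis E (dual_indep E indep) X \<longleftrightarrow> X \<subseteq> E \<and> basis E indep (E - X)"
proof
  assume X: "basis E (dual_indep E indep) X"
  then have "dual_indep E indep X"
    by (simp add: basis_def)
  then obtain B where B: "basis E indep B" "X \<subseteq> E - B"
    unfolding dual_indep_def by blast
  then have d: "dual_indep E indep (E - B)" unfolding dual_indep_def by blast
  have "\<forall>Y\<subseteq>E. dual_indep E indep Y \<longrightarrow> X \<subseteq> Y \<longrightarrow> Y = X"
    using X by (simp add: basis_def)
  with d B(2) have eq: "E - B = X" by blast
  have "B \<subseteq> E" using B(1) by (simp add: basis_def)
  with eq have "B = E - X" by blast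
  with B show "X \<subseteq> E \<and> basis E indep (E - X)" by blast
next
  assume X: "X \<subseteq> E \<and> basis E indep (E - X)"
  have dX: "dual_indep E indep X"
    unfolding dual_indep_def using X by (intro exI[of _ "E - X"]) auto
  have "Y = X" if Y: "dual_indep E indep Y" "X \<subseteq> Y" for Y
  proof -
    obtain B where B: "basis E indep B" "Y \<subseteq> E - B"
      using Y(1) unfolding dual_indep_def by blast
    have BE: "B \<subseteq> E" and max: "\<And>Z. Z \<subseteq> E \<Longrightarrow> indep Z \<Longrightarrow> B \<subseteq> Z \<Longrightarrow> Z = B"
      using B(1) by (simp_all add: basis_def)
    have "indep (E - X)" using X by (simp add: basis_def)
    moreover have "B \<subseteq> E - X" using BE B(2) Y(2) by blast
    ultimately have "E - X = B" using max by blast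
    then show ?thesis using B(2) Y(2) X by blast
  qed
  then show "basis E (dual_indep E indep) X"
    using dX X by (simp add: basis_def)
qed

end

end

theory Submission
  imports Defs "HOL-Library.Disjoint_Sets"
begin

text \<open>
  A circuit \<open>C\<close> of a minor extends by contracted elements to a circuit of \<open>M\<close>, and a cocircuit
  \<open>D\<close> extends by deleted elements to a cocircuit of \<open>M\<close>, so that \<open>C \<inter> D\<close> survives. Hence
  any minor with an intersection of size \<open>k\<close> may replace \<open>M\<close>. Contracting and deleting as long
  as possible leads to a minor in which one set \<open>X\<close> of \<open>k\<close> elements is both a
  circuit and a cocircuit, and every \<open>y\<close> outside \<open>X\<close> lies in a circuit and in a cocircuit inside
  \<open>X \<union> {y}\<close> (\<open>tight_minor\<close>). Then \<open>X\<close> minus an element is a basis of the minor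
  and of its dual, which leaves exactly \<open>k - 2\<close> elements outside \<open>X\<close>.

  For \<open>y\<close> outside \<open>X\<close>, the complements in \<open>X\<close> of the circuits through \<open>y\<close> inside
  \<open>X \<union> {y}\<close> partition \<open>X\<close>: they are the series classes of the restriction to \<open>X \<union> {y}\<close>
  other than \<open>{y}\<close> (\<open>partition_on_blocks\<close>). Dually the cocircuits give a second partition of
  \<open>X\<close>. Thus each \<open>y\<close> carries two partitions \<open>\<P> y\<close> and \<open>\<Q> y\<close> of \<open>X\<close>. A circuit and a cocircuit
  never meet in exactly one element; if they never meet in \<open>k - 2\<close> elements either, then block
  sizes and sizes of unions of a block of \<open>\<P> y\<close> with a block of \<open>\<Q> z\<close> must avoid certain values.

  The contradiction (\<open>partition_pair.inconsistent\<close>) is now a matter of counting. No block has size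
  \<open>2\<close>, \<open>k - 1\<close> or \<open>k\<close>. As \<open>k \<le> 6\<close>, a partition without singletons therefore consists of two
  triples, and \<open>k = 6\<close>; and a partition with a singleton has at least two of them. The partitions
  \<open>\<P> y\<close> and \<open>\<Q> y\<close> either both have singletons or both do not, and two different
  elements cannot both have singletons, as two singletons \<open>{p} \<in> \<P> y\<close> and \<open>{q} \<in> \<Q> z\<close> with
  \<open>p \<noteq> q\<close> would have a union of the forbidden size \<open>2\<close>. So at most one of the \<open>k - 2 \<ge> 2\<close>
  elements has singletons. Some other element has none, which forces \<open>k = 6\<close>, and then at least
  three elements \<open>y\<^sub>1, y\<^sub>2, y\<^sub>3\<close> have only triples. For distinct \<open>y\<close> and \<open>z\<close> among them, unions of size
  \<open>5\<close> are forbidden, so a triple of \<open>\<P> y\<close> is a triple of \<open>\<Q> z\<close>. Going round, a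
  triple of \<open>\<P> y\<^sub>1\<close> belongs to \<open>\<Q> y\<^sub>2\<close>, \<open>\<P> y\<^sub>3\<close> and \<open>\<Q> y\<^sub>1\<close>, but unions of size \<open>3\<close> are forbidden
  between \<open>\<P> y\<^sub>1\<close> and \<open>\<Q> y\<^sub>1\<close>.
\<close>

section \<open>Circuits of a matroid and of its dual\<close>

text \<open>Independence in the contraction of \<open>e\<close>, provided that \<open>e\<close> is not a loop. Deletion of \<open>e\<close>
  is expressed as its contraction in the dual.\<close>

definition contract :: "('a set \<Rightarrow> bool) \<Rightarrow> 'a \<Rightarrow> 'a set \<Rightarrow> bool" where
  "contract indep e I \<longleftrightarrow> e \<notin> I \<and> indep (insert e I)"

text \<open>Complements are taken because these sets, unlike the circuits themselves, are
  disjoint.\<close>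

definition blocks :: "'a set \<Rightarrow> ('a set \<Rightarrow> bool) \<Rightarrow> 'a set \<Rightarrow> 'a \<Rightarrow> 'a set set" where
  "blocks E indep X y = {X - C |C. circuit E indep C \<and> y \<in> C \<and> C \<subseteq> insert y X}"

text \<open>Some matroid on \<open>E - {e}\<close> (it will be the contraction or the deletion of \<open>e\<close>) keeps the intersection
  \<open>X\<close> and creates no new intersections.\<close>

definition removable :: "'a set \<Rightarrow> ('a set \<Rightarrow> bool) \<Rightarrow> 'a set \<Rightarrow> 'a \<Rightarrow> bool" where
  "removable E indep X e \<longleftrightarrow> (\<exists>indep'. matroid (E - {e}) indep'
    \<and> circuit_cocircuit_intersection (E - {e}) indep' X
    \<and> circuit_cocircuit_intersection (E - {e}) indep' \<le> circuit_cocircuit_intersection E indep)"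

context matroid
begin

lemma finite_circuit: "circuit E indep C \<Longrightarrow> finite C"
  using finite_ground finite_subset unfolding circuit_def by blast

lemma circuit_diff_indep: "circuit E indep C \<Longrightarrow> x \<in> C \<Longrightarrow> indep (C - {x})"
  unfolding circuit_def by blast

lemma circuit_not_subset_indep: "circuit E indep C \<Longrightarrow> indep I \<Longrightarrow> \<not> C \<subseteq> I"
  unfolding circuit_def using indep_subset by blast

lemma circuit_subset_eq:
  assumes "circuit E indep C" "circuit E indep C'" "C \<subseteq> C'"
  shows "C = C'"
  using assms unfolding circuit_def by blast

lemma dependent_contains_circuit:
  assumes "W \<subseteq> E" "\<not> indep W"
  obtains C where "circuit E indep C" "C \<subseteq> W"
proof -
  have "finite {S. S \<subseteq> W \<and> \<not> indep S}"
    using assms(1) finite_ground by (auto intro: finite_subset[of _ "Pow E"])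
  moreover have "W \<in> {S. S \<subseteq> W \<and> \<not> indep S}" using assms by blast
  ultimately obtain C where C': "C \<in> {S. S \<subseteq> W \<and> \<not> indep S}"
    and min': "\<forall>S\<in>{S. S \<subseteq> W \<and> \<not> indep S}. S \<subseteq> C \<longrightarrow> C = S"
    using finite_has_minimal[of "{S. S \<subseteq> W \<and> \<not> indep S}"] by (metis (no_types, lifting) emptyE)
  have C: "C \<subseteq> W" "\<not> indep C" using C' by auto
  have min: "S = C" if "S \<subseteq> C" "\<not> indep S" for S using min' that C by blast
  have "circuit E indep C"
    unfolding circuit_def using C min assms(1) by blast
  then show thesis using that C(1) by blast
qed

lemma indep_extends_to_basis:
  assumes "indep I" "basis E indep B"
  obtains Z where "basis E indep Z" "I \<subseteq> Z" "Z \<subseteq> I \<union> B"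
proof -
  have "indep B" using assms(2) by (simp add: basis_def)
  then obtain Z where "indep Z" "I \<subseteq> Z" "Z \<subseteq> I \<union> B" "card Z = card B"
    using extend_from[OF assms(1) _ basis_card_ge[OF assms(2,1)]] by blast
  then show thesis using that basis_iff_card[OF assms(2)] by blast
qed

lemma dual_dual: "dual_indep E (dual_indep E indep) = indep"
proof
  fix I
  have "dual_indep E (dual_indep E indep) I \<longleftrightarrow> (\<exists>B. basis E indep B \<and> I \<subseteq> B)"
  proof
    assume "dual_indep E (dual_indep E indep) I"
    then show "\<exists>B. basis E indep B \<and> I \<subseteq> B"
      unfolding dual_indep_def[of E "dual_indep E indep"] basis_dual_iff by blast
  next
    assume "\<exists>B. basis E indep B \<and> I \<subseteq> B"
    then obtain B where B: "basis E indep B" "I \<subseteq> B" by blast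
    then have "E - (E - B) = B" by (auto simp: basis_def)
    then have "basis E (dual_indep E indep) (E - B)" "I \<subseteq> E - (E - B)"
      using B basis_dual_iff[of "E - B"] by auto
    then show "dual_indep E (dual_indep E indep) I"
      unfolding dual_indep_def[of E "dual_indep E indep"] by blast
  qed
  also have "\<dots> \<longleftrightarrow> indep I"
  proof
    assume "\<exists>B. basis E indep B \<and> I \<subseteq> B"
    then show "indep I" using indep_subset unfolding basis_def by blast
  next
    assume "indep I"
    then show "\<exists>B. basis E indep B \<and> I \<subseteq> B"
      using basis_exists indep_extends_to_basis[of I] by metis
  qed
  finally show "dual_indep E (dual_indep E indep) I = indep I" .
qed

lemma circuit_cocircuit_intersection_dual:
  "circuit_cocircuit_intersection E (dual_indep E indep) = circuit_cocircuit_intersection E indep"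
  unfolding circuit_cocircuit_intersection_def cocircuit_def dual_dual by (auto simp: fun_eq_iff)

text \<open>If \<open>C \<inter> D = {e}\<close>, take a basis that meets \<open>D\<close> at most in \<open>e\<close> and exchange it for one that
  contains \<open>C - {e}\<close>. The new basis cannot contain \<open>e\<close> as well, so it misses \<open>D\<close> altogether,
  and \<open>D\<close> would be independent in the dual.\<close>

lemma circuit_cocircuit_not_singleton:
  assumes C: "circuit E indep C" and D: "cocircuit E indep D"
  shows "card (C \<inter> D) \<noteq> 1"
proof
  assume "card (C \<inter> D) = 1"
  then obtain e where e: "C \<inter> D = {e}" by (auto simp: card_1_singleton_iff)
  have "dual_indep E indep (D - {e})"
    using D e unfolding cocircuit_def circuit_def by blast
  then obtain B where B: "basis E indep B" "D - {e} \<subseteq> E - B"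
    unfolding dual_indep_def by blast
  have "indep (C - {e})" using circuit_diff_indep[OF C] e by blast
  then obtain Z where Z: "basis E indep Z" "C - {e} \<subseteq> Z" "Z \<subseteq> (C - {e}) \<union> B"
    using indep_extends_to_basis B(1) by blast
  have "\<not> C \<subseteq> Z" using circuit_not_subset_indep[OF C] Z(1) unfolding basis_def by blast
  then have "e \<notin> Z" using Z(2) by blast
  moreover have "D \<subseteq> E" using D unfolding cocircuit_def circuit_def by blast
  ultimately have "D \<subseteq> E - Z" using Z(3) B(2) e by blast
  then have "dual_indep E indep D" using Z(1) unfolding dual_indep_def by blast
  then show False using D unfolding cocircuit_def circuit_def by blast
qed

section \<open>Circuits through one element outside a circuit\<close>

text \<open>For \<open>z \<in> C - C'\<close>, the independent set \<open>C - {z}\<close> extends inside \<open>I \<union> {y}\<close> to an independent set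
  of size \<open>|I|\<close>, which misses only one element. That element must be \<open>z\<close>, so \<open>C'\<close> is included in an
  independent set.\<close>

lemma circuit_unique:
  assumes I: "indep I"
    and C: "circuit E indep C" "C \<subseteq> insert y I"
    and C': "circuit E indep C'" "C' \<subseteq> insert y I"
  shows "C = C'"
proof (rule ccontr)
  assume "C \<noteq> C'"
  then obtain z where z: "z \<in> C" "z \<notin> C'"
    using circuit_subset_eq[OF C(1) C'(1)] by blast
  have fin: "finite I" using finite_indep[OF I] .
  have yI: "y \<notin> I" using circuit_not_subset_indep[OF C(1) I] C(2) by blast
  have "card (C - {z}) \<le> card (insert y I - {z})"
    using C(2) fin by (intro card_mono) auto
  also have "\<dots> = card I" using z(1) C(2) fin yI by (simp add: subset_iff)
  finally obtain Z where Z: "indep Z" "C - {z} \<subseteq> Z" "Z \<subseteq> (C - {z}) \<union> I" "card Z = card I"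
    using extend_from[OF circuit_diff_indep[OF C(1) z(1)] I] by blast
  have "z \<notin> Z" using circuit_not_subset_indep[OF C(1) Z(1)] Z(2) by blast
  then have "Z \<subseteq> insert y I - {z}" using Z(3) C(2) by blast
  moreover have "card (insert y I - {z}) = card I"
    using z(1) C(2) fin yI by (simp add: subset_iff)
  ultimately have "Z = insert y I - {z}" using Z(4) fin by (intro card_subset_eq) auto
  then have "C' \<subseteq> Z" using C'(2) z(2) by blast
  then show False using circuit_not_subset_indep[OF C'(1) Z(1)] by blast
qed

text \<open>A special case of strong circuit elimination. If \<open>X \<union> {y}\<close> minus \<open>x\<close> were independent, then
  \<open>C - {y}\<close> would extend inside \<open>X \<union> {y}\<close> to an independent set with \<open>|X|\<close> elements; not
  containing \<open>y\<close>, that set would be \<open>X\<close>.\<close>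

lemma circuit_avoiding:
  assumes X: "circuit E indep X"
    and C: "circuit E indep C" "y \<in> C" "C \<subseteq> insert y X"
    and "y \<notin> X" and "x \<in> X"
  obtains C' where "circuit E indep C'" "y \<in> C'" "C' \<subseteq> insert y X - {x}"
proof -
  have fin: "finite X" using finite_circuit[OF X] .
  have "\<not> indep (insert y X - {x})"
  proof
    let ?J = "insert y X - {x}"
    assume J: "indep ?J"
    have cJ: "card ?J = card X" using assms(5,6) fin by simp
    have "card (C - {y}) \<le> card X" using C fin by (intro card_mono) auto
    then obtain Z where Z: "indep Z" "C - {y} \<subseteq> Z" "Z \<subseteq> (C - {y}) \<union> ?J" "card Z = card X"
      using extend_from[OF circuit_diff_indep[OF C(1,2)] J] cJ by auto
    have "y \<notin> Z" using circuit_not_subset_indep[OF C(1) Z(1)] Z(2) by blast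
    then have "Z \<subseteq> X" using Z(3) C(3) by blast
    then have "Z = X" using Z(4) fin by (intro card_subset_eq) auto
    then show False using Z(1) X unfolding circuit_def by blast
  qed
  moreover have "insert y X - {x} \<subseteq> E" using X C(1,2) unfolding circuit_def by blast
  ultimately obtain C' where C': "circuit E indep C'" "C' \<subseteq> insert y X - {x}"
    using dependent_contains_circuit by blast
  moreover have "y \<in> C'"
    using circuit_not_subset_indep[OF C'(1) circuit_diff_indep[OF X \<open>x \<in> X\<close>]] C'(2) by blast
  ultimately show thesis using that by blast
qed

text \<open>The blocks cover \<open>X\<close> since some circuit through \<open>y\<close> avoids any given \<open>x \<in> X\<close>, and they are
  disjoint since that circuit is unique, \<open>X - {x}\<close> being independent.\<close>

lemma partition_on_blocks:
  assumes X: "circuit E indep X" and y: "y \<notin> X"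
    and C: "\<exists>C. circuit E indep C \<and> y \<in> C \<and> C \<subseteq> insert y X"
  shows "partition_on X (blocks E indep X y)"
proof (rule partition_onI)
  show "{} \<notin> blocks E indep X y"
  proof
    assume "{} \<in> blocks E indep X y"
    then obtain C where "circuit E indep C" "y \<in> C" "X \<subseteq> C"
      unfolding blocks_def by blast
    then show False using circuit_subset_eq[OF X] y by blast
  qed
  have "x \<in> \<Union> (blocks E indep X y)" if "x \<in> X" for x
  proof -
    obtain C' where "circuit E indep C'" "y \<in> C'" "C' \<subseteq> insert y X - {x}"
      using C circuit_avoiding[OF X _ _ _ y \<open>x \<in> X\<close>] by metis
    then show ?thesis unfolding blocks_def using \<open>x \<in> X\<close> by blast
  qed
  then show "\<Union> (blocks E indep X y) = X" unfolding blocks_def by blast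
  show "disjnt p p'" if p: "p \<in> blocks E indep X y" "p' \<in> blocks E indep X y" "p \<noteq> p'" for p p'
  proof (rule ccontr)
    assume "\<not> disjnt p p'"
    then obtain x where x: "x \<in> p" "x \<in> p'" unfolding disjnt_def by blast
    obtain C C' where C: "circuit E indep C" "C \<subseteq> insert y X" "p = X - C"
      and C': "circuit E indep C'" "C' \<subseteq> insert y X" "p' = X - C'"
      using p unfolding blocks_def by blast
    have "indep (X - {x})" using circuit_diff_indep[OF X] x C(3) by blast
    moreover have "C \<subseteq> insert y (X - {x})" "C' \<subseteq> insert y (X - {x})" using C C' x by auto
    ultimately have "C = C'" using circuit_unique C(1) C'(1) by blast
    then show False using C(3) C'(3) p(3) by blast
  qed
qed

section \<open>Passing to a minor\<close>

lemma matroid_contract: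
  assumes e: "indep {e}"
  shows "matroid (E - {e}) (contract indep e)"
proof
  show "finite (E - {e})" using finite_ground by blast
  show "X \<subseteq> E - {e}" if "contract indep e X" for X
    using that indep_subset_ground unfolding contract_def by blast
  show "contract indep e {}" using e unfolding contract_def by simp
  show "contract indep e Y" if "contract indep e X" "Y \<subseteq> X" for X Y
    using that indep_subset[of "insert e X" "insert e Y"] unfolding contract_def by blast
next
  fix X Y
  assume X: "contract indep e X" and Y: "contract indep e Y" and less: "card X < card Y"
  have "finite X" "finite Y"
    using X Y finite_indep[of "insert e X"] finite_indep[of "insert e Y"]
    unfolding contract_def by auto
  then have "card (insert e X) < card (insert e Y)"
    using X Y less unfolding contract_def by simp
  then obtain y where "y \<in> insert e Y - insert e X" "indep (insert y (insert e X))"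
    using X Y indep_augment unfolding contract_def by blast
  then show "\<exists>y\<in>Y - X. contract indep e (insert y X)"
    using X unfolding contract_def by (auto simp: insert_commute)
qed

lemma dual_indep_contract:
  assumes e: "indep {e}"
  shows "dual_indep (E - {e}) (contract indep e) X \<longleftrightarrow> dual_indep E indep X \<and> e \<notin> X"
proof
  assume "dual_indep (E - {e}) (contract indep e) X"
  then obtain B where B: "basis (E - {e}) (contract indep e) B" "X \<subseteq> (E - {e}) - B"
    unfolding dual_indep_def by blast
  have iB: "indep (insert e B)" "e \<notin> B"
    using B(1) unfolding basis_def contract_def by auto
  have "W = insert e B" if W: "indep W" "insert e B \<subseteq> W" for W
  proof -
    have "insert e (W - {e}) = W" using W(2) by blast
    then have "contract indep e (W - {e})" using W(1) unfolding contract_def by simp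
    moreover have "W - {e} \<subseteq> E - {e}" "B \<subseteq> W - {e}"
      using W indep_subset_ground iB(2) by auto
    ultimately have "W - {e} = B" using B(1) unfolding basis_def by blast
    then show ?thesis using W(2) by blast
  qed
  then have "basis E indep (insert e B)"
    unfolding basis_def using iB(1) indep_subset_ground[OF iB(1)] by blast
  moreover have "X \<subseteq> E - insert e B" using B(2) by blast
  ultimately show "dual_indep E indep X \<and> e \<notin> X" unfolding dual_indep_def by blast
next
  assume X: "dual_indep E indep X \<and> e \<notin> X"
  then obtain B where B: "basis E indep B" "X \<subseteq> E - B" unfolding dual_indep_def by blast
  obtain Z where Z: "basis E indep Z" "{e} \<subseteq> Z" "Z \<subseteq> {e} \<union> B"
    using indep_extends_to_basis[OF e B(1)] by blast
  have eZ: "insert e (Z - {e}) = Z" using Z(2) by blast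
  have ZE: "Z \<subseteq> E" "indep Z" and max: "\<And>W. W \<subseteq> E \<Longrightarrow> indep W \<Longrightarrow> Z \<subseteq> W \<Longrightarrow> W = Z"
    using Z(1) by (simp_all add: basis_def)
  have "basis (E - {e}) (contract indep e) (Z - {e})"
    unfolding basis_def
  proof (intro conjI allI impI)
    show "Z - {e} \<subseteq> E - {e}" using ZE by blast
    show "contract indep e (Z - {e})" using eZ ZE unfolding contract_def by simp
    fix W
    assume W: "W \<subseteq> E - {e}" "contract indep e W" "Z - {e} \<subseteq> W"
    then have "insert e W = Z"
      using max[of "insert e W"] eZ indep_subset_ground unfolding contract_def by blast
    then show "W = Z - {e}" using W(1) by blast
  qed
  moreover have "X \<subseteq> (E - {e}) - (Z - {e})" using X B(2) Z(3) by blast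
  ultimately show "dual_indep (E - {e}) (contract indep e) X" unfolding dual_indep_def by blast
qed

text \<open>Contraction of \<open>e\<close> is deletion of \<open>e\<close> in the dual.\<close>

lemma cocircuit_contract_iff:
  assumes "indep {e}"
  shows "cocircuit (E - {e}) (contract indep e) D \<longleftrightarrow> cocircuit E indep D \<and> e \<notin> D"
  unfolding cocircuit_def circuit_def dual_indep_contract[OF assms] by blast

lemma circuit_contract_lift:
  assumes e: "indep {e}" and C: "circuit (E - {e}) (contract indep e) C"
  shows "circuit E indep C \<or> circuit E indep (insert e C)"
proof -
  have eC: "e \<notin> C" "C \<subseteq> E" and dep: "\<not> indep (insert e C)"
    and sub: "\<And>W. W \<subset> C \<Longrightarrow> indep (insert e W)"
    using C unfolding circuit_def contract_def by auto
  have eE: "e \<in> E" using e indep_subset_ground by blast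
  show ?thesis
  proof (cases "indep C")
    case True
    have "indep W" if "W \<subset> insert e C" for W
    proof (cases "C \<subseteq> W")
      case True
      then have "W \<subseteq> C" using that by blast
      then show ?thesis using \<open>indep C\<close> indep_subset by blast
    next
      case False
      then have "W - {e} \<subset> C" using that eC by blast
      then show ?thesis using sub[of "W - {e}"] indep_subset[of _ W] by blast
    qed
    then show ?thesis unfolding circuit_def using eC eE dep by blast
  next
    case False
    have "indep W" if "W \<subset> C" for W
      using sub[OF that] indep_subset by blast
    then show ?thesis unfolding circuit_def using eC False by blast
  qed
qed

text \<open>A circuit of the contraction may gain \<open>e\<close> when lifted, but a cocircuit of the contraction
  avoids \<open>e\<close>, so the intersection stays the same.\<close>

lemma circuit_cocircuit_intersection_contract:
  assumes e: "indep {e}"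
    and "circuit_cocircuit_intersection (E - {e}) (contract indep e) Z"
  shows "circuit_cocircuit_intersection E indep Z"
proof -
  obtain C D where C: "circuit (E - {e}) (contract indep e) C"
    and D: "cocircuit E indep D" "e \<notin> D" and Z: "Z = C \<inter> D"
    using assms(2) unfolding circuit_cocircuit_intersection_def cocircuit_contract_iff[OF e] by blast
  have "Z = insert e C \<inter> D" using D(2) Z by blast
  then show ?thesis
    using circuit_contract_lift[OF e C] D(1) Z
    unfolding circuit_cocircuit_intersection_def by blast
qed

text \<open>If \<open>e \<notin> C\<close>, contracting \<open>e\<close> keeps \<open>C\<close> a circuit exactly because no circuit inside
  \<open>C \<union> {e}\<close> passes through \<open>e\<close>; this also excludes that \<open>e\<close> is a loop.\<close>

lemma circuit_contract:
  assumes C: "circuit E indep C" and "C - {e} \<noteq> {}"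
    and e: "e \<in> C \<or> \<not> (\<exists>K. circuit E indep K \<and> e \<in> K \<and> K \<subseteq> insert e C)"
    and eE: "e \<in> E"
  shows "indep {e}" "circuit (E - {e}) (contract indep e) (C - {e})"
proof -
  have CE: "C \<subseteq> E" using C unfolding circuit_def by blast
  have *: "indep (insert e W)" if W: "W \<subset> C - {e}" for W
  proof (cases "e \<in> C")
    case True
    then have "insert e W \<subset> C" using W by blast
    then show ?thesis using C unfolding circuit_def by blast
  next
    case False
    show ?thesis
    proof (rule ccontr)
      assume "\<not> indep (insert e W)"
      moreover have "insert e W \<subseteq> E" using W CE eE by blast
      ultimately obtain K where K: "circuit E indep K" "K \<subseteq> insert e W"
        using dependent_contains_circuit by blast
      have "e \<notin> K" using e K W False by blast
      then have "K \<subset> C" using K(2) W by blast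
      then show False using K(1) C unfolding circuit_def by blast
    qed
  qed
  show "indep {e}" using *[of "{}"] assms(2) by blast
  have "\<not> indep (insert e (C - {e}))"
    using C indep_subset[of "insert e (C - {e})" C] unfolding circuit_def by blast
  then show "circuit (E - {e}) (contract indep e) (C - {e})"
    using CE * unfolding circuit_def contract_def by blast
qed

lemma contraction_step:
  assumes C: "circuit E indep C" and D: "cocircuit E indep D"
    and k: "C \<inter> D \<noteq> {}"
    and e: "e \<in> E - D"
      "e \<in> C \<or> \<not> (\<exists>K. circuit E indep K \<and> e \<in> K \<and> K \<subseteq> insert e C)"
  shows "removable E indep (C \<inter> D) e"
proof -
  have "C - {e} \<noteq> {}" using k e(1) by blast
  note con = circuit_contract[OF C this e(2)]
  have i: "indep {e}" using con e(1) by blast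
  have "circuit (E - {e}) (contract indep e) (C - {e})" using con e(1) by blast
  moreover have "cocircuit (E - {e}) (contract indep e) D"
    using D e(1) cocircuit_contract_iff[OF i] by blast
  moreover have "C \<inter> D = (C - {e}) \<inter> D" using e(1) by blast
  ultimately have "circuit_cocircuit_intersection (E - {e}) (contract indep e) (C \<inter> D)"
    unfolding circuit_cocircuit_intersection_def by blast
  then show ?thesis
    unfolding removable_def
    using matroid_contract[OF i] circuit_cocircuit_intersection_contract[OF i] by blast
qed

text \<open>The contraction step applied to the dual matroid.\<close>

lemma deletion_step:
  assumes C: "circuit E indep C" and D: "cocircuit E indep D"
    and k: "C \<inter> D \<noteq> {}"
    and e: "e \<in> E - C"
      "e \<in> D \<or> \<not> (\<exists>K. cocircuit E indep K \<and> e \<in> K \<and> K \<subseteq> insert e D)"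
  shows "removable E indep (C \<inter> D) e"
proof -
  have "removable E (dual_indep E indep) (D \<inter> C) e"
    using assms dual_dual
    by (intro matroid.contraction_step[OF dual_matroid]) (auto simp: cocircuit_def)
  then show ?thesis
    unfolding removable_def circuit_cocircuit_intersection_dual by (simp add: Int_commute)
qed

end

text \<open>Once nothing can be removed, both \<open>C - D\<close> and \<open>D - C\<close> are empty, as their elements could be
  contracted and deleted respectively; and an element outside \<open>X = C = D\<close> that can be neither
  contracted nor deleted is spanned by \<open>X\<close> in the matroid and in its dual.\<close>

lemma tight_minor:
  assumes "matroid E indep" "circuit E indep C" "cocircuit E indep D" "C \<inter> D \<noteq> {}"
  shows "\<exists>E' indep' X. matroid E' indep' \<and> circuit E' indep' X \<and> cocircuit E' indep' X
    \<and> card X = card (C \<inter> D)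
    \<and> (\<forall>y\<in>E' - X. \<exists>K. circuit E' indep' K \<and> y \<in> K \<and> K \<subseteq> insert y X)
    \<and> (\<forall>y\<in>E' - X. \<exists>K. cocircuit E' indep' K \<and> y \<in> K \<and> K \<subseteq> insert y X)
    \<and> circuit_cocircuit_intersection E' indep' \<le> circuit_cocircuit_intersection E indep"
  using assms
proof (induction "card E" arbitrary: E indep C D rule: less_induct)
  case less
  interpret matroid E indep by (rule less.prems)
  note C = less.prems(2) and D = less.prems(3) and ne = less.prems(4)
  let ?contractible = "\<lambda>e. e \<in> E - D \<and>
    (e \<in> C \<or> \<not> (\<exists>K. circuit E indep K \<and> e \<in> K \<and> K \<subseteq> insert e C))"
  let ?deletable = "\<lambda>e. e \<in> E - C \<and>
    (e \<in> D \<or> \<not> (\<exists>K. cocircuit E indep K \<and> e \<in> K \<and> K \<subseteq> insert e D))"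
  show ?case
  proof (cases "\<exists>e. ?contractible e \<or> ?deletable e")
    case True
    then obtain e where e: "?contractible e \<or> ?deletable e" by blast
    then have "removable E indep (C \<inter> D) e"
      using contraction_step[OF C D ne] deletion_step[OF C D ne] by blast
    then obtain indep' C' D' where M': "matroid (E - {e}) indep'" "circuit (E - {e}) indep' C'"
      "cocircuit (E - {e}) indep' D'" "C \<inter> D = C' \<inter> D'"
      and le: "circuit_cocircuit_intersection (E - {e}) indep' \<le> circuit_cocircuit_intersection E indep"
      unfolding removable_def circuit_cocircuit_intersection_def[of "E - {e}" _ "C \<inter> D"] by blast
    have "card (E - {e}) < card E"
      using e finite_ground by (intro psubset_card_mono) auto
    from less.hyps[OF this M'(1-3)] M'(4) ne obtain E' J X where
      "matroid E' J" "circuit E' J X" "cocircuit E' J X" "card X = card (C \<inter> D)"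
      "\<forall>y\<in>E' - X. \<exists>K. circuit E' J K \<and> y \<in> K \<and> K \<subseteq> insert y X"
      "\<forall>y\<in>E' - X. \<exists>K. cocircuit E' J K \<and> y \<in> K \<and> K \<subseteq> insert y X"
      "circuit_cocircuit_intersection E' J \<le> circuit_cocircuit_intersection (E - {e}) indep'"
      by metis
    with order_trans[OF this(7) le] show ?thesis by blast
  next
    case False
    have "C \<subseteq> E" "D \<subseteq> E" using C D unfolding cocircuit_def circuit_def by auto
    then have "C = D" using False by blast
    then have "\<forall>y\<in>E - C. \<exists>K. circuit E indep K \<and> y \<in> K \<and> K \<subseteq> insert y C"
      "\<forall>y\<in>E - C. \<exists>K. cocircuit E indep K \<and> y \<in> K \<and> K \<subseteq> insert y C"
      using False by auto
    moreover have "cocircuit E indep C" "card C = card (C \<inter> D)" using \<open>C = D\<close> D by auto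
    ultimately show ?thesis using C less.prems(1) by blast
  qed
qed

context matroid
begin

lemma basis_circuit_diff:
  assumes X: "circuit E indep X" and x: "x \<in> X"
    and Y: "\<forall>y\<in>E - X. \<exists>K. circuit E indep K \<and> y \<in> K \<and> K \<subseteq> insert y X"
  shows "basis E indep (X - {x})"
proof -
  have "W = X - {x}" if W: "indep W" "X - {x} \<subseteq> W" for W
  proof (rule ccontr)
    assume "W \<noteq> X - {x}"
    then obtain w where w: "w \<in> W" "w \<notin> X - {x}" using W(2) by blast
    show False
    proof (cases "w = x")
      case True
      then have "X \<subseteq> W" using w(1) W(2) by blast
      then show False using circuit_not_subset_indep[OF X W(1)] by blast
    next
      case False
      then have "w \<in> E - X" using w W(1) indep_subset_ground by blast
      then obtain C where "circuit E indep C" "C \<subseteq> insert w X - {x}"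
        using Y circuit_avoiding[OF X _ _ _ _ x] by (metis DiffD2)
      then show False using circuit_not_subset_indep[OF _ W(1)] w(1) W(2) by blast
    qed
  qed
  then show ?thesis
    unfolding basis_def using circuit_diff_indep[OF X x] indep_subset_ground by blast
qed

text \<open>For \<open>x \<in> X\<close> the set \<open>X - {x}\<close> is a basis of the matroid and of its dual, so the ground set has
  \<open>2 (|X| - 1)\<close> elements.\<close>

lemma card_outside:
  assumes X: "circuit E indep X" "cocircuit E indep X" "2 \<le> card X"
    and Y: "\<forall>y\<in>E - X. \<exists>K. circuit E indep K \<and> y \<in> K \<and> K \<subseteq> insert y X"
      "\<forall>y\<in>E - X. \<exists>K. cocircuit E indep K \<and> y \<in> K \<and> K \<subseteq> insert y X"
  shows "card (E - X) = card X - 2"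
proof -
  obtain x where x: "x \<in> X" using X(3) by fastforce
  have XE: "X \<subseteq> E" "finite X"
    using X(1) finite_circuit unfolding circuit_def by auto
  have 1: "basis E indep (X - {x})" using basis_circuit_diff[OF X(1) x Y(1)] .
  have "basis E (dual_indep E indep) (X - {x})"
    using matroid.basis_circuit_diff[OF dual_matroid] X(2) x Y(2) unfolding cocircuit_def by blast
  then have 2: "basis E indep (E - (X - {x}))" using basis_dual_iff by blast
  then have "card (E - (X - {x})) = card (X - {x})"
    using basis_iff_card[OF 1] unfolding basis_def by blast
  moreover have "E - (X - {x}) = insert x (E - X)" using x XE by blast
  ultimately show ?thesis using x XE finite_ground by simp
qed

end

section \<open>Two families of partitions\<close>

lemma disjoint_card_add_le:
  assumes "finite X" "p \<subseteq> X" "q \<subseteq> X" "p \<inter> q = {}"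
  shows "card p + card q \<le> card X"
proof -
  have "card p + card q = card (p \<union> q)"
    using assms by (metis card_Un_disjoint finite_subset)
  also have "\<dots> \<le> card X" using assms by (intro card_mono) auto
  finally show ?thesis .
qed

lemma partition_block_of:
  assumes "partition_on X \<P>" "x \<in> X"
  obtains p where "p \<in> \<P>" "x \<in> p" "p \<subseteq> X"
  using assms unfolding partition_on_def by blast

lemma partition_blocks_disjoint:
  assumes "partition_on X \<P>" "p \<in> \<P>" "q \<in> \<P>" "p \<noteq> q"
  shows "p \<inter> q = {}"
  using assms unfolding partition_on_def disjoint_def by blast

text \<open>Without a second singleton, all blocks other than \<open>{a}\<close> have at least three elements. Two of
  them do not fit into the at most five remaining elements, and a single one would have the excluded size
  \<open>|X| - 1\<close>.\<close>

lemma partition_second_singleton: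
  assumes fin: "finite X" and k: "2 \<le> card X" "card X \<le> 6"
    and part: "partition_on X \<P>"
    and size: "\<And>p. p \<in> \<P> \<Longrightarrow> card p \<noteq> 2 \<and> card p \<noteq> card X - 1"
    and a: "{a} \<in> \<P>"
  shows "\<exists>b. b \<noteq> a \<and> {b} \<in> \<P>"
proof (rule ccontr)
  assume no: "\<not> (\<exists>b. b \<noteq> a \<and> {b} \<in> \<P>)"
  have aX: "a \<in> X" using a part unfolding partition_on_def by blast
  have cardX: "card (X - {a}) = card X - 1" using aX fin by simp
  have *: "a \<notin> p \<and> 3 \<le> card p" if p: "p \<in> \<P>" "x \<in> p" "x \<noteq> a" "p \<subseteq> X" for p x
  proof -
    have "p \<noteq> {a}" using p by blast
    then have "p \<inter> {a} = {}" using partition_blocks_disjoint[OF part p(1) a] by simp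
    then have "card p \<noteq> 1" using no p(1) by (auto simp: card_1_singleton_iff)
    moreover have "card p \<noteq> 0" using p(2) finite_subset[OF p(4) fin] by auto
    ultimately show ?thesis using size[OF p(1)] \<open>p \<inter> {a} = {}\<close> by auto
  qed
  have "X - {a} \<noteq> {}" using cardX k(1) by (metis One_nat_def card.empty diff_is_0_eq not_less_eq_eq numeral_2_eq_2)
  then obtain x where x: "x \<in> X" "x \<noteq> a" by blast
  obtain p where p: "p \<in> \<P>" "x \<in> p" "p \<subseteq> X" using partition_block_of[OF part x(1)] .
  have "p \<noteq> X - {a}" using size[OF p(1)] cardX by auto
  then obtain z where z: "z \<in> X" "z \<noteq> a" "z \<notin> p" using p *[OF p(1,2) x(2)] by blast
  obtain q where q: "q \<in> \<P>" "z \<in> q" "q \<subseteq> X" using partition_block_of[OF part z(1)] .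
  have "p \<inter> q = {}" using partition_blocks_disjoint[OF part p(1) q(1)] q(2) z(3) by blast
  then have "card p + card q \<le> card (X - {a})"
    using *[OF p(1,2) x(2) p(3)] *[OF q(1,2) z(2) q(3)] p q fin
    by (intro disjoint_card_add_le) auto
  then show False
    using *[OF p(1,2) x(2) p(3)] *[OF q(1,2) z(2) q(3)] cardX k by linarith
qed

text \<open>At least two blocks, each with at least three elements, have to fit into at most six.\<close>

lemma partition_no_singleton:
  assumes fin: "finite X" and k: "card X \<le> 6"
    and part: "partition_on X \<P>"
    and size: "\<And>p. p \<in> \<P> \<Longrightarrow> card p \<noteq> 1 \<and> card p \<noteq> 2 \<and> card p \<noteq> card X"
    and p: "p \<in> \<P>"
  shows "card p = 3" "card X = 6"
proof -
  have *: "q \<subseteq> X \<and> 3 \<le> card q" if q: "q \<in> \<P>" for q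
  proof -
    have "q \<subseteq> X" "q \<noteq> {}" using q part unfolding partition_on_def by auto
    then have "card q \<noteq> 0" using fin by (auto dest: finite_subset)
    then show ?thesis using size[OF q] \<open>q \<subseteq> X\<close> by auto
  qed
  have "p \<noteq> X" using size[OF p] by blast
  then obtain z where z: "z \<in> X" "z \<notin> p" using *[OF p] by blast
  obtain q where q: "q \<in> \<P>" "z \<in> q" using partition_block_of[OF part z(1)] .
  have "p \<inter> q = {}" using partition_blocks_disjoint[OF part p q(1)] q(2) z(2) by blast
  then have "card p + card q \<le> card X"
    using *[OF p] *[OF q(1)] fin by (intro disjoint_card_add_le) auto
  then show "card p = 3" "card X = 6" using *[OF p] *[OF q(1)] k by linarith+
qed

text \<open>As \<open>|p \<union> q| = 6 - |p \<inter> q|\<close>, no block may meet \<open>p\<close> in exactly one element. But if \<open>p\<close> is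
  spread over several blocks, one of them does.\<close>

lemma triple_in_triple_partition:
  assumes part: "partition_on X \<Q>" and three: "\<And>q. q \<in> \<Q> \<Longrightarrow> card q = 3"
    and p: "p \<subseteq> X" "card p = 3"
    and un: "\<And>q. q \<in> \<Q> \<Longrightarrow> card (p \<union> q) \<noteq> 5"
  shows "p \<in> \<Q>"
proof -
  have finp: "finite p" using p(2) by (metis card.infinite zero_neq_numeral)
  have finq: "finite q" if "q \<in> \<Q>" for q
    using three[OF that] by (metis card.infinite zero_neq_numeral)
  have not1: "card (p \<inter> q) \<noteq> 1" if q: "q \<in> \<Q>" for q
    using card_Un_Int[OF finp finq[OF q]] p(2) three[OF q] un[OF q] by linarith
  have pos: "card (p \<inter> q) \<noteq> 0" if "x \<in> p" "x \<in> q" for x q using that finp by auto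
  obtain x where x: "x \<in> p" using p(2) by fastforce
  obtain q where q: "q \<in> \<Q>" "x \<in> q" using partition_block_of[OF part] x p(1) by blast
  show ?thesis
  proof (cases "p \<subseteq> q")
    case True
    then have "p = q" using p(2) three[OF q(1)] finq[OF q(1)] by (intro card_subset_eq) auto
    then show ?thesis using q by simp
  next
    case False
    then obtain z where z: "z \<in> p" "z \<notin> q" by blast
    obtain r where r: "r \<in> \<Q>" "z \<in> r" using partition_block_of[OF part] z(1) p(1) by blast
    have "q \<inter> r = {}" using partition_blocks_disjoint[OF part q(1) r(1)] r(2) z(2) by blast
    then have "card (p \<inter> q) + card (p \<inter> r) \<le> card p"
      using finp by (intro disjoint_card_add_le) auto
    then show ?thesis
      using not1[OF q(1)] not1[OF r(1)] pos[OF x q(2)] pos[OF z(1) r(2)] p(2) by linarith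
  qed
qed

text \<open>The numerical conditions translate the absence of circuit-cocircuit intersections of size
  \<open>1\<close> and \<open>|X| - 2\<close>. The circuit \<open>(X - p) \<union> {y}\<close> meets the cocircuit \<open>X\<close> in \<open>|X| - |p|\<close> elements,
  and it meets the cocircuit \<open>(X - q) \<union> {z}\<close> in \<open>|X| - |p \<union> q|\<close> elements, plus one if \<open>y = z\<close>.
  The conditions are symmetric in \<open>\<P>\<close> and \<open>\<Q>\<close>, which reflects duality.\<close>

locale partition_pair =
  fixes X :: "'a set" and Y :: "'b set" and \<P> \<Q> :: "'b \<Rightarrow> 'a set set"
  assumes finite_X: "finite X"
    and card_X: "4 \<le> card X" "card X \<le> 6"
    and card_Y: "card Y = card X - 2"
    and partition: "\<And>y. y \<in> Y \<Longrightarrow> partition_on X (\<P> y)" "\<And>y. y \<in> Y \<Longrightarrow> partition_on X (\<Q> y)"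
    and size: "\<And>y p. y \<in> Y \<Longrightarrow> p \<in> \<P> y \<union> \<Q> y \<Longrightarrow> card p \<noteq> 2 \<and> card p \<noteq> card X - 1"
    and same: "\<And>y p q. y \<in> Y \<Longrightarrow> p \<in> \<P> y \<Longrightarrow> q \<in> \<Q> y \<Longrightarrow>
      card (p \<union> q) \<noteq> 3 \<and> card (p \<union> q) \<noteq> card X"
    and different: "\<And>y z p q. y \<in> Y \<Longrightarrow> z \<in> Y \<Longrightarrow> y \<noteq> z \<Longrightarrow> p \<in> \<P> y \<Longrightarrow> q \<in> \<Q> z \<Longrightarrow>
      card (p \<union> q) \<noteq> 2 \<and> card (p \<union> q) \<noteq> card X - 1"
begin

lemma swap: "partition_pair X Y \<Q> \<P>"
proof
  show "card (p \<union> q) \<noteq> 3 \<and> card (p \<union> q) \<noteq> card X" if "y \<in> Y" "p \<in> \<Q> y" "q \<in> \<P> y" for y p q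
    using same[OF that(1,3,2)] by (simp add: Un_commute)
  show "card (p \<union> q) \<noteq> 2 \<and> card (p \<union> q) \<noteq> card X - 1"
    if "y \<in> Y" "z \<in> Y" "y \<noteq> z" "p \<in> \<Q> y" "q \<in> \<P> z" for y z p q
    using different[OF that(2,1) that(3)[symmetric] that(5,4)] by (simp add: Un_commute)
qed (use finite_X card_X card_Y partition size in auto)

text \<open>The set \<open>X\<close> itself is not a block of \<open>\<P> y\<close>, since its union with any block of \<open>\<Q> y\<close> would
  have the excluded size \<open>|X|\<close>. So \<open>\<P> y\<close> has no block of size \<open>1\<close>, \<open>2\<close> or \<open>|X|\<close>.\<close>

lemma triples:
  assumes y: "y \<in> Y" and no: "\<And>a. {a} \<notin> \<P> y" and p: "p \<in> \<P> y"
  shows "card p = 3" "card X = 6"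
proof -
  have not_X: "card p' \<noteq> card X" if p': "p' \<in> \<P> y" for p'
  proof
    assume "card p' = card X"
    moreover have "p' \<subseteq> X" using p' partition(1)[OF y] unfolding partition_on_def by blast
    ultimately have "p' = X" using finite_X by (simp add: card_subset_eq)
    obtain x where "x \<in> X" using card_X by fastforce
    then obtain q where "q \<in> \<Q> y" "q \<subseteq> X" using partition_block_of[OF partition(2)[OF y]] by blast
    then show False using same[OF y p'] \<open>p' = X\<close> by (metis Un_absorb2)
  qed
  have "card p' \<noteq> 1" if "p' \<in> \<P> y" for p'
    using no that by (auto simp: card_1_singleton_iff)
  then have "card p' \<noteq> 1 \<and> card p' \<noteq> 2 \<and> card p' \<noteq> card X" if "p' \<in> \<P> y" for p'
    using that not_X size[OF y] by blast
  from partition_no_singleton[OF finite_X card_X(2) partition(1)[OF y] this p]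
  show "card p = 3" "card X = 6" by auto
qed

text \<open>Otherwise all blocks of \<open>\<Q> y\<close> are triples, and the one that contains \<open>a\<close> has a union of size
  \<open>3\<close> with \<open>{a}\<close>.\<close>

lemma singleton_transfer:
  assumes y: "y \<in> Y" and a: "{a} \<in> \<P> y"
  shows "\<exists>b. {b} \<in> \<Q> y"
proof (rule ccontr)
  assume no: "\<not> ?thesis"
  have "a \<in> X" using a partition(1)[OF y] unfolding partition_on_def by blast
  then obtain q where q: "q \<in> \<Q> y" "a \<in> q" using partition_block_of[OF partition(2)[OF y]] by blast
  have "card q = 3" using partition_pair.triples(1)[OF swap y _ q(1)] no by blast
  moreover have "{a} \<union> q = q" using q(2) by blast
  ultimately show False using same[OF y a q(1)] by simp
qed

text \<open>If \<open>y \<noteq> z\<close>, then \<open>\<Q> z\<close> has a singleton \<open>{c}\<close>, and one of the two or more singletons of \<open>\<P> y\<close>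
  differs from it, giving a union of the excluded size \<open>2\<close>.\<close>

lemma singletons_same_index:
  assumes y: "y \<in> Y" "{a} \<in> \<P> y" and z: "z \<in> Y" "{b} \<in> \<P> z"
  shows "y = z"
proof (rule ccontr)
  assume neq: "y \<noteq> z"
  obtain c where c: "{c} \<in> \<Q> z" using singleton_transfer[OF z] by blast
  have "\<exists>d. d \<noteq> a \<and> {d} \<in> \<P> y"
    using partition_second_singleton[OF finite_X _ card_X(2) partition(1)[OF y(1)] _ y(2)]
      size[OF y(1)] card_X(1) by auto
  then obtain d where d: "d \<noteq> c" "{d} \<in> \<P> y" using y(2) by metis
  have "card ({d} \<union> {c}) = 2" using d(1) by simp
  then show False using different[OF y(1) z(1) neq d(2) c] by blast
qed

lemma triple_transfer:
  assumes "y \<in> Y" "z \<in> Y" "y \<noteq> z" and no: "\<And>a. {a} \<notin> \<Q> z"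
    and p: "p \<in> \<P> y" "card p = 3"
  shows "p \<in> \<Q> z"
proof (rule triple_in_triple_partition)
  show "partition_on X (\<Q> z)" using partition(2)[OF \<open>z \<in> Y\<close>] .
  show 3: "card q = 3" if "q \<in> \<Q> z" for q
    using partition_pair.triples(1)[OF swap \<open>z \<in> Y\<close> no that] .
  show "p \<subseteq> X" using p(1) partition(1)[OF \<open>y \<in> Y\<close>] unfolding partition_on_def by blast
  show "card p = 3" by (rule p)
  show "card (p \<union> q) \<noteq> 5" if q: "q \<in> \<Q> z" for q
    using different[OF assms(1-3) p(1) q] partition_pair.triples(2)[OF swap \<open>z \<in> Y\<close> no q] by simp
qed

lemma inconsistent: False
proof -
  \<comment> \<open>At most one index has singleton blocks; every other index carries only triples.\<close>
  define S where "S = {y \<in> Y. \<exists>a. {a} \<in> \<P> y}"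
  have finY: "finite Y" using card_Y card_X by (intro card_ge_0_finite) linarith
  have S1: "card S \<le> 1"
  proof -
    have "\<forall>y\<in>S. \<forall>z\<in>S. y = z" using singletons_same_index unfolding S_def by blast
    moreover have "finite S" using finY unfolding S_def by simp
    ultimately show ?thesis using card_le_Suc0_iff_eq[of S] by simp
  qed
  have no: "{a} \<notin> \<P> y" "{a} \<notin> \<Q> y" if "y \<in> Y - S" for y a
    using that partition_pair.singleton_transfer[OF swap] unfolding S_def by auto
  have block: "\<exists>p. p \<in> \<P> y" if y: "y \<in> Y" for y
  proof -
    obtain x where "x \<in> X" using card_X by fastforce
    then show ?thesis using partition_block_of[OF partition(1)[OF y]] by blast
  qed
  have cYS: "card (Y - S) = card Y - card S"
    unfolding S_def using finY by (intro card_Diff_subset) auto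
  then have "0 < card (Y - S)" using S1 card_Y card_X by linarith
  then obtain y1 where y1: "y1 \<in> Y - S" by (metis card_gt_0_iff ex_in_conv)
  obtain p where p: "p \<in> \<P> y1" using block y1 by blast
  have p3: "card p = 3" and X6: "card X = 6" using triples[OF _ no(1)[OF y1] p] y1 by auto
  \<comment> \<open>Now \<open>|Y| = 4\<close>, so there are three such indices; the same triple is passed around them.\<close>
  have "3 \<le> card (Y - S)" using cYS S1 card_Y X6 by linarith
  then have "2 \<le> card (Y - S - {y1})" using y1 finY by simp
  then obtain T where T: "T \<subseteq> Y - S - {y1}" "card T = 2" by (meson obtain_subset_with_card_n)
  then obtain y2 y3 where "T = {y2, y3}" "y2 \<noteq> y3" by (auto simp: card_2_iff)
  then have y: "y1 \<in> Y" "y2 \<in> Y" "y3 \<in> Y" "y2 \<in> Y - S" "y3 \<in> Y - S"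
    "y1 \<noteq> y2" "y2 \<noteq> y3" "y3 \<noteq> y1"
    using T y1 by auto
  have "p \<in> \<Q> y2" using triple_transfer[OF y(1,2,6) no(2)[OF y(4)] p p3] .
  then have "p \<in> \<P> y3"
    using partition_pair.triple_transfer[OF swap y(2,3,7) no(1)[OF y(5)] _ p3] by blast
  then have "p \<in> \<Q> y1" using triple_transfer[OF y(3,1,8) no(2)[OF y1] _ p3] by blast
  then show False using same[OF y(1) p, of p] p3 by simp
qed

end

section \<open>The partitions of a matroid without the smaller intersection\<close>

lemma (in matroid) partition_pair_blocks:
  assumes X: "circuit E indep X" "cocircuit E indep X" "4 \<le> card X" "card X \<le> 6"
    and Y: "\<forall>y\<in>E - X. \<exists>K. circuit E indep K \<and> y \<in> K \<and> K \<subseteq> insert y X"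
      "\<forall>y\<in>E - X. \<exists>K. cocircuit E indep K \<and> y \<in> K \<and> K \<subseteq> insert y X"
    and none: "\<And>Z. circuit_cocircuit_intersection E indep Z \<Longrightarrow> card Z \<noteq> card X - 2"
  shows "partition_pair X (E - X) (blocks E indep X) (blocks E (dual_indep E indep) X)"
proof
  have fin: "finite X" using finite_circuit[OF X(1)] .
  then show "finite X" .
  show "4 \<le> card X" "card X \<le> 6" by fact+
  show "card (E - X) = card X - 2" using card_outside X Y by simp
  show "partition_on X (blocks E indep X y)" if "y \<in> E - X" for y
    using partition_on_blocks[OF X(1)] Y(1) that by blast
  show "partition_on X (blocks E (dual_indep E indep) X y)" if "y \<in> E - X" for y
    using matroid.partition_on_blocks[OF dual_matroid] X(2) Y(2) that unfolding cocircuit_def by blast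
  have sizes: "card (C \<inter> D) \<noteq> 1 \<and> card (C \<inter> D) \<noteq> card X - 2"
    if "circuit E indep C" "cocircuit E indep D" for C D
    using that circuit_cocircuit_not_singleton none
    unfolding circuit_cocircuit_intersection_def by blast
  have compl: "card (X - W) = card X - card W \<and> card W \<le> card X" if "W \<subseteq> X" for W
    using that fin by (auto simp: card_Diff_subset finite_subset card_mono)
  have 1: "\<exists>C. circuit E indep C \<and> y \<in> C \<and> C = insert y (X - p) \<and> p \<subseteq> X"
    if "p \<in> blocks E indep X y" for y p
    using that unfolding blocks_def by blast
  have 2: "\<exists>D. cocircuit E indep D \<and> y \<in> D \<and> D = insert y (X - q) \<and> q \<subseteq> X"
    if "q \<in> blocks E (dual_indep E indep) X y" for y q
    using that unfolding blocks_def cocircuit_def by blast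
  show "card p \<noteq> 2 \<and> card p \<noteq> card X - 1"
    if y: "y \<in> E - X" and p: "p \<in> blocks E indep X y \<union> blocks E (dual_indep E indep) X y" for y p
  proof -
    have pX: "p \<subseteq> X" using p unfolding blocks_def by blast
    have "insert y (X - p) \<inter> X = X - p" "X \<inter> insert y (X - p) = X - p" using y by auto
    then have "card (X - p) \<noteq> 1 \<and> card (X - p) \<noteq> card X - 2"
      using p 1[of p y] 2[of p y] sizes X(1,2) by (metis Un_iff)
    then show ?thesis using compl[OF pX] X(3) by auto
  qed
  show "card (p \<union> q) \<noteq> 3 \<and> card (p \<union> q) \<noteq> card X"
    if y: "y \<in> E - X" and p: "p \<in> blocks E indep X y"
      and q: "q \<in> blocks E (dual_indep E indep) X y" for y p q
  proof -
    have pq: "p \<union> q \<subseteq> X" using p q unfolding blocks_def by blast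
    have "insert y (X - p) \<inter> insert y (X - q) = insert y (X - (p \<union> q))" by blast
    moreover have "card (insert y (X - (p \<union> q))) = Suc (card (X - (p \<union> q)))" using y fin by simp
    ultimately have "Suc (card (X - (p \<union> q))) \<noteq> 1 \<and> Suc (card (X - (p \<union> q))) \<noteq> card X - 2"
      using 1[OF p] 2[OF q] sizes by metis
    then show ?thesis using compl[OF pq] X(3) by auto
  qed
  show "card (p \<union> q) \<noteq> 2 \<and> card (p \<union> q) \<noteq> card X - 1"
    if y: "y \<in> E - X" "z \<in> E - X" "y \<noteq> z" and p: "p \<in> blocks E indep X y"
      and q: "q \<in> blocks E (dual_indep E indep) X z" for y z p q
  proof -
    have pq: "p \<union> q \<subseteq> X" using p q unfolding blocks_def by blast
    have "insert y (X - p) \<inter> insert z (X - q) = X - (p \<union> q)" using y by blast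
    then have "card (X - (p \<union> q)) \<noteq> 1 \<and> card (X - (p \<union> q)) \<noteq> card X - 2"
      using 1[OF p] 2[OF q] sizes by metis
    then show ?thesis using compl[OF pq] X(3) by auto
  qed
qed

theorem theorem2p2:
  fixes E :: "'a set" and indep :: "'a set \<Rightarrow> bool" and k :: nat
  assumes "matroid E indep"
    and "4 \<le> k" and "k \<le> 6"
    and "\<exists>X. circuit_cocircuit_intersection E indep X \<and> card X = k"
  shows "\<exists>Y. circuit_cocircuit_intersection E indep Y \<and> card Y = k - 2"
proof (rule ccontr)
  assume none: "\<not> ?thesis"
  obtain C D where CD: "circuit E indep C" "cocircuit E indep D" "card (C \<inter> D) = k"
    using assms(4) unfolding circuit_cocircuit_intersection_def by blast
  have "C \<inter> D \<noteq> {}" using CD(3) assms(2) by auto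
  from tight_minor[OF assms(1) CD(1,2) this] obtain E' indep' X where
    M: "matroid E' indep'" and X: "circuit E' indep' X" "cocircuit E' indep' X" "card X = k"
    and Y: "\<forall>y\<in>E' - X. \<exists>K. circuit E' indep' K \<and> y \<in> K \<and> K \<subseteq> insert y X"
      "\<forall>y\<in>E' - X. \<exists>K. cocircuit E' indep' K \<and> y \<in> K \<and> K \<subseteq> insert y X"
    and le: "circuit_cocircuit_intersection E' indep' \<le> circuit_cocircuit_intersection E indep"
    using CD(3) by blast
  have "card Z \<noteq> card X - 2" if "circuit_cocircuit_intersection E' indep' Z" for Z
    using that le none X(3) by blast
  then have "partition_pair X (E' - X) (blocks E' indep' X) (blocks E' (dual_indep E' indep') X)"
    using matroid.partition_pair_blocks[OF M X(1,2) _ _ Y] X(3) assms(2,3) by blast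
  then show False by (rule partition_pair.inconsistent)
qed

end
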